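(* Let $n\geq2$ and let $G$ be a finite simple graph of order $n$ with domination number $\gamma(G)=\gamma>0$. Let $\lambda(G)$ denote the largest eigenvalue of the Laplacian matrix of $G$. Then \[ \lambda(G)\geq\left\lceil n/\gamma\right\rceil. \] Equality holds if and only if $G=G_1\cup G_2$ (vertex-disjoint union), where $G_1$ and $G_2$ satisfy: (i) $|G_1|=\lceil n/\gamma\rceil$ and $\gamma(G_1)=1$; (ii) $\gamma(G_2)=\gamma-1$ and $\lambda(G_2)\leq\lceil n/\gamma\rceil$.
   Context: The Laplacian of a graph is $D-A$, where $D$ is the diagonal matrix of vertex degrees and $A$ the adjacency matrix; $\lambda(H)$ is its largest eigenvalue. A set $X\subseteq V(G)$ is dominating if every vertex $u\in V(G)\setminus X$ has a neighbor in $X$; the domination number $\gamma(G)$ is the minimum size of a dominating set. $|H|$ denotes the number of vertices of $H$, and $G_1\cup G_2$ denotes the disjoint union of graphs.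
   Formalization: The formal theorem additionally assumes that G has at least one edge; for edgeless G of order n≥2 one has γ=n, ⌈n/γ⌉=1 but λ(G)=0, so the stated inequality and the equality characterization both fail. *)

theory Defs
  imports
    "Graph_Theory.Pair_Digraph"
    "Jordan_Normal_Form.Char_Poly"
    "HOL-Library.Countable_Set"
begin

text \<open>
  A finite simple graph is a \<^locale>\<open>pair_graph\<close>: a finite, loop-free, symmetric digraph in which
  an edge \<open>uv\<close> is the pair of arcs \<open>(u, v)\<close> and \<open>(v, u)\<close>. The locale admits the graph without
  vertices, which can occur as a summand of a disjoint union.
\<close>

definition dominating :: "'a pair_pre_digraph \<Rightarrow> 'a set \<Rightarrow> bool" where
  "dominating G X \<longleftrightarrow> X \<subseteq> pverts G \<and> (\<forall>u \<in> pverts G - X. \<exists>v \<in> X. (u, v) \<in> parcs G)"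

definition domination_number :: "'a pair_pre_digraph \<Rightarrow> nat" where
  "domination_number G = Min (card ` {X. dominating G X})"

text \<open>
  Rows and columns are numbered along \<^term>\<open>from_nat_into (pverts G)\<close>, which is a bijection from
  \<^term>\<open>{..<card (pverts G)}\<close> onto the finite vertex set. Any other numbering yields a
  permutation-similar matrix, with the same eigenvalues. Since the arc set is symmetric, the number
  of outgoing arcs at a vertex is its degree.
\<close>

definition degree_matrix :: "'a pair_pre_digraph \<Rightarrow> real mat" where
  "degree_matrix G = mat (card (pverts G)) (card (pverts G))
     (\<lambda>(i, j). if i = j then real (out_degree (with_proj G) (from_nat_into (pverts G) i)) else 0)"

definition adjacency_matrix :: "'a pair_pre_digraph \<Rightarrow> real mat" where
  "adjacency_matrix G = mat (card (pverts G)) (card (pverts G))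
     (\<lambda>(i, j). if (from_nat_into (pverts G) i, from_nat_into (pverts G) j) \<in> parcs G then 1 else 0)"

definition laplacian_matrix :: "'a pair_pre_digraph \<Rightarrow> real mat" where
  "laplacian_matrix G = degree_matrix G - adjacency_matrix G"

text \<open>
  The Laplacian of the graph without vertices has no eigenvalues; we use the value \<open>0\<close> for it. For all
  other graphs the matrix is real symmetric, so the set of real eigenvalues is the full spectrum,
  finite and nonempty.
\<close>

definition largest_laplacian_eigenvalue :: "'a pair_pre_digraph \<Rightarrow> real" where
  "largest_laplacian_eigenvalue G =
     (if pverts G = {} then 0 else Max {k. eigenvalue (laplacian_matrix G) k})"

definition is_disjoint_union ::
    "'a pair_pre_digraph \<Rightarrow> 'a pair_pre_digraph \<Rightarrow> 'a pair_pre_digraph \<Rightarrow> bool" where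
  "is_disjoint_union G G1 G2 \<longleftrightarrow>
     pverts G1 \<inter> pverts G2 = {} \<and>
     G = \<lparr> pverts = pverts G1 \<union> pverts G2, parcs = parcs G1 \<union> parcs G2 \<rparr>"

end

theory Submission
  imports Defs
    "HOL-Analysis.Function_Topology"
    "Jordan_Normal_Form.Spectral_Radius"
begin

text \<open>
  Closed neighbourhoods of the vertices of a minimum dominating set cover the graph, so
  \<open>n \<le> \<gamma> (\<Delta> + 1)\<close>, and \<open>\<lambda> \<ge> \<Delta> + 1\<close> by a test vector supported on the closed neighbourhood
  of a vertex of maximum degree. If \<open>\<lambda> = \<lceil>n / \<gamma>\<rceil>\<close>, both bounds are tight, no edge leaves this closed
  neighbourhood, and it splits off as \<open>G\<^sub>1\<close>. Conversely, \<open>\<lambda>(G)\<close> is the maximum of \<open>\<lambda>(G\<^sub>1)\<close> and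
  \<open>\<lambda>(G\<^sub>2)\<close>, and \<open>\<lambda>(G\<^sub>1) \<le> |G\<^sub>1|\<close>. All eigenvalue bounds go through the Rayleigh quotient.
\<close>

section \<open>The largest eigenvalue of a real symmetric matrix\<close>

lemma finite_eigenvalues:
  fixes A :: "'a::field mat"
  assumes "A \<in> carrier_mat n n"
  shows "finite {k. eigenvalue A k}"
  using card_finite_spectrum(1)[OF assms] by (simp add: spectrum_def)

text \<open>Weierstrass: a quadratic form is continuous and the unit sphere is compact. Vectors are
  functions on \<open>nat\<close> here so that compactness can come from the product
  topology.\<close>

lemma quadratic_form_attains_sup:
  fixes a :: "nat \<Rightarrow> nat \<Rightarrow> real"
  assumes "0 < n"
  obtains x where "(\<Sum>i<n. (x i)\<^sup>2) = 1"
    "\<forall>y. (\<Sum>i<n. (y i)\<^sup>2) = 1 \<longrightarrow>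
      (\<Sum>i<n. \<Sum>j<n. y i * a i j * y j) \<le> (\<Sum>i<n. \<Sum>j<n. x i * a i j * x j)"
proof -
  define q where "q x = (\<Sum>i<n. \<Sum>j<n. x i * a i j * x j)" for x :: "nat \<Rightarrow> real"
  define N where "N x = (\<Sum>i<n. (x i)\<^sup>2)" for x :: "nat \<Rightarrow> real"
  \<comment> \<open>Pinning all coordinates from \<open>n\<close> on to 0 makes \<open>P\<close> a
    product of compact sets, although the space of all functions is infinite-dimensional. The sphere
    \<open>K\<close> is a closed part of it.\<close>
  define P :: "(nat \<Rightarrow> real) set" where
    "P = PiE UNIV (\<lambda>i. if i < n then {-1..1} else {0})"
  define K where "K = P \<inter> {x. N x = 1}"
  \<comment> \<open>Truncation changes neither \<open>N\<close> nor \<open>q\<close>, so a maximiser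
    on \<open>K\<close> is also a maximiser among all functions with \<open>N y = 1\<close>.\<close>
  have N_upd: "N (\<lambda>i. if i < n then y i else 0) = N y"
    and q_upd: "q (\<lambda>i. if i < n then y i else 0) = q y" for y
    by (auto simp: N_def q_def intro!: sum.cong)
  have "compactin (product_topology (\<lambda>_. euclidean) UNIV) P"
    unfolding P_def by (subst compactin_PiE) auto
  then have "compact P"
    by (simp add: euclidean_product_topology)
  moreover have "continuous_on UNIV N"
    unfolding N_def by (intro continuous_intros) auto
  then have "closed {x. N x = 1}"
    by (intro closed_Collect_eq continuous_on_const)
  ultimately have "compact K"
    unfolding K_def by (rule compact_Int_closed)
  moreover have "K \<noteq> {}"
  proof -
    have "(\<lambda>i. if i = 0 then 1 else 0) \<in> K"
      using assms by (auto simp: K_def P_def N_def if_distrib[of "\<lambda>x. x\<^sup>2"] cong: if_cong)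
    then show ?thesis by blast
  qed
  moreover have "continuous_on K q"
    unfolding q_def by (intro continuous_intros continuous_on_subset[OF continuous_on_product_coordinates]) auto
  ultimately obtain x where x: "x \<in> K" "\<And>y. y \<in> K \<Longrightarrow> q y \<le> q x"
    using continuous_attains_sup by metis
  have "q y \<le> q x" if "N y = 1" for y
  proof -
    have "\<bar>y i\<bar> \<le> 1" if "i < n" for i
    proof -
      have "(y i)\<^sup>2 \<le> N y"
        unfolding N_def using that by (intro member_le_sum) auto
      then show ?thesis using \<open>N y = 1\<close> by (simp add: abs_square_le_1)
    qed
    then have "(\<lambda>i. if i < n then y i else 0) \<in> K"
      using \<open>N y = 1\<close> N_upd[of y] by (auto simp: K_def P_def abs_le_iff)
    then show ?thesis using x(2) q_upd by metis
  qed
  with x(1) show thesis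
    by (intro that[of x]) (auto simp: K_def N_def q_def)
qed

text \<open>
  The maximiser of the Rayleigh quotient is an eigenvector: the form \<open>k |x|\<^sup>2 - x A x\<close> is positive
  semidefinite and vanishes at the maximiser, hence so does its gradient.
\<close>

lemma symmetric_mat_largest_eigenvalue:
  fixes A :: "real mat"
  assumes A: "A \<in> carrier_mat n n" and sym: "A\<^sup>T = A" and "0 < n"
  obtains k where "eigenvalue A k"
    "\<forall>v \<in> carrier_vec n. v \<bullet> (A *\<^sub>v v) \<le> k * (v \<bullet> v)"
proof -
  have norm: "v \<bullet> v = (\<Sum>i<n. (v $ i)\<^sup>2)" if "v \<in> carrier_vec n" for v :: "real vec"
    unfolding scalar_prod_def carrier_vecD[OF that] power2_eq_square atLeast0LessThan ..
  have form: "v \<bullet> (A *\<^sub>v v) = (\<Sum>i<n. \<Sum>j<n. v $ i * A $$ (i, j) * v $ j)"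
    if "v \<in> carrier_vec n" for v
  proof -
    have "v \<bullet> (A *\<^sub>v v) = (\<Sum>i<n. v $ i * (\<Sum>j<n. A $$ (i, j) * v $ j))"
      using that A by (simp add: scalar_prod_def atLeast0LessThan)
    then show ?thesis by (simp add: sum_distrib_left mult.assoc)
  qed
  obtain f where f: "(\<Sum>i<n. (f i)\<^sup>2) = 1"
    "\<forall>y. (\<Sum>i<n. (y i)\<^sup>2) = 1 \<longrightarrow>
      (\<Sum>i<n. \<Sum>j<n. y i * A $$ (i, j) * y j) \<le> (\<Sum>i<n. \<Sum>j<n. f i * A $$ (i, j) * f j)"
    using quadratic_form_attains_sup[OF \<open>0 < n\<close>, of "\<lambda>i j. A $$ (i, j)"] .
  define x where "x = vec n f"
  have x: "x \<in> carrier_vec n" and xx: "x \<bullet> x = 1"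
    using f(1) norm[of x] by (auto simp: x_def)
  define k where "k = x \<bullet> (A *\<^sub>v x)"
  have le1: "y \<bullet> (A *\<^sub>v y) \<le> k" if "y \<in> carrier_vec n" "y \<bullet> y = 1" for y
    using f(2)[rule_format, of "\<lambda>i. y $ i"] form[OF that(1)] norm[OF that(1)] that(2) form[OF x]
    by (simp add: k_def x_def)
  have le: "v \<bullet> (A *\<^sub>v v) \<le> k * (v \<bullet> v)" if v: "v \<in> carrier_vec n" for v
  proof (cases "v \<bullet> v = 0")
    case True
    then have "\<forall>i<n. v $ i = 0"
      unfolding norm[OF v] by (subst (asm) sum_nonneg_eq_0_iff) auto
    then show ?thesis using form[OF v] True by simp
  next
    case False
    define s where "s = v \<bullet> v"
    have "s \<ge> 0" unfolding s_def norm[OF v] by (intro sum_nonneg) auto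
    with False have s: "s > 0" by (simp add: s_def)
    define w where "w = (1 / sqrt s) \<cdot>\<^sub>v v"
    have w: "w \<in> carrier_vec n" using v by (simp add: w_def)
    have "w \<bullet> w = 1"
      using s v unfolding w_def by (simp add: s_def[symmetric])
    then have "w \<bullet> (A *\<^sub>v w) \<le> k" by (rule le1[OF w])
    moreover have "w \<bullet> (A *\<^sub>v w) = (v \<bullet> (A *\<^sub>v v)) / s"
      using s v A by (simp add: w_def mult_mat_vec[OF A v])
    ultimately show ?thesis using s by (simp add: divide_le_eq s_def)
  qed
  have "A *\<^sub>v x = k \<cdot>\<^sub>v x"
  proof -
    \<comment> \<open>Up to the factor 2, \<open>w\<close> is the gradient at \<open>x\<close> of
      the form \<open>k |x|^2 - x A x\<close>; the aim is \<open>w = 0\<close>.\<close>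
    define w where "w = k \<cdot>\<^sub>v x - A *\<^sub>v x"
    have Ax: "A *\<^sub>v x \<in> carrier_vec n" using A x by simp
    have w: "w \<in> carrier_vec n" using Ax x by (simp add: w_def)
    have Aw: "A *\<^sub>v w \<in> carrier_vec n" using A w by simp
    have sw: "x \<bullet> (A *\<^sub>v w) = w \<bullet> (A *\<^sub>v x)"
      using transpose_vec_mult_scalar[OF A x w] sym comm_scalar_prod[OF x Aw]
      by (metis Ax Aw comm_scalar_prod w)
    define q where "q = k * (w \<bullet> w) - w \<bullet> (A *\<^sub>v w)"
    have q: "q \<ge> 0" using le[OF w] by (simp add: q_def)
    have ww: "w \<bullet> w = k * (w \<bullet> x) - w \<bullet> (A *\<^sub>v x)"
      using scalar_prod_minus_distrib[OF w _ Ax, of "k \<cdot>\<^sub>v x"] x w by (simp add: w_def[symmetric])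
    \<comment> \<open>The right-hand side is the value of the semidefinite form at
      \<open>x + t w\<close>: the constant term vanishes at the maximiser, and \<open>q\<close> is
      the value at \<open>w\<close>.\<close>
    have nonneg: "0 \<le> 2 * t * (w \<bullet> w) + t\<^sup>2 * q" for t
    proof -
      have tw: "t \<cdot>\<^sub>v w \<in> carrier_vec n" using w by simp
      have xt: "x + t \<cdot>\<^sub>v w \<in> carrier_vec n" using x tw by simp
      have "A *\<^sub>v (x + t \<cdot>\<^sub>v w) = A *\<^sub>v x + t \<cdot>\<^sub>v (A *\<^sub>v w)"
        using mult_add_distrib_mat_vec[OF A x tw] mult_mat_vec[OF A w] by simp
      then have "(x + t \<cdot>\<^sub>v w) \<bullet> (A *\<^sub>v (x + t \<cdot>\<^sub>v w)) =
          k + 2 * t * (w \<bullet> (A *\<^sub>v x)) + t\<^sup>2 * (w \<bullet> (A *\<^sub>v w))"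
        using x w Ax Aw sw
        by (simp add: add_scalar_prod_distrib[of _ n] scalar_prod_add_distrib[of _ n]
            k_def power2_eq_square algebra_simps)
      moreover have "(x + t \<cdot>\<^sub>v w) \<bullet> (x + t \<cdot>\<^sub>v w) = 1 + 2 * t * (w \<bullet> x) + t\<^sup>2 * (w \<bullet> w)"
        using x w xx comm_scalar_prod[OF x w]
        by (simp add: add_scalar_prod_distrib[of _ n] scalar_prod_add_distrib[of _ n]
            power2_eq_square algebra_simps)
      moreover have "2 * t * (w \<bullet> w) = 2 * t * k * (w \<bullet> x) - 2 * t * (w \<bullet> (A *\<^sub>v x))"
        unfolding ww by (simp add: algebra_simps)
      ultimately show ?thesis
        using le[OF xt] by (simp add: q_def algebra_simps)
    qed
    have "w \<bullet> w \<ge> 0" unfolding norm[OF w] by (intro sum_nonneg) auto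
    moreover have "\<not> w \<bullet> w > 0"
    proof
      assume s: "w \<bullet> w > 0"
      define s where "s = w \<bullet> w"
      \<comment> \<open>The parameter \<open>t = - u\<close> makes the linear term outweigh the
        quadratic one. The summand 1 keeps the denominator positive when
        \<open>q = 0\<close>.\<close>
      define u where "u = s / (q + 1)"
      have u: "u > 0" "s = u * (q + 1)"
        using q s by (simp_all add: u_def s_def)
      have "0 \<le> 2 * (- u) * s + (- u)\<^sup>2 * q"
        using nonneg[of "- u"] by (simp add: s_def)
      also have "\<dots> = - (u\<^sup>2 * (q + 2))"
        unfolding u(2) by (simp add: power2_eq_square algebra_simps)
      also have "\<dots> < 0"
        using q u(1) by simp
      finally show False by simp
    qed
    ultimately have "\<forall>i<n. w $ i = 0"
      using norm[OF w] by (simp add: sum_nonneg_eq_0_iff)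
    then show ?thesis
      using A x by (intro eq_vecI) (auto simp: w_def)
  qed
  moreover have "x \<noteq> 0\<^sub>v n"
    using xx x by auto
  ultimately have "eigenvalue A k"
    using A x by (auto simp: eigenvalue_def eigenvector_def)
  with le show thesis by (intro that) auto
qed

text \<open>This turns eigenvalue bounds into bounds on a quadratic form. An eigenvector has its
  eigenvalue as Rayleigh quotient, and the maximum of the quotient is itself an eigenvalue.\<close>

lemma Max_eigenvalue_le_iff:
  fixes A :: "real mat"
  assumes A: "A \<in> carrier_mat n n" and sym: "A\<^sup>T = A" and "0 < n"
  shows "Max {k. eigenvalue A k} \<le> c \<longleftrightarrow>
    (\<forall>v \<in> carrier_vec n. v \<bullet> (A *\<^sub>v v) \<le> c * (v \<bullet> v))"
proof -
  obtain k where k: "eigenvalue A k"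
    "\<forall>v \<in> carrier_vec n. v \<bullet> (A *\<^sub>v v) \<le> k * (v \<bullet> v)"
    using symmetric_mat_largest_eigenvalue[OF assms] .
  have pos: "0 \<le> v \<bullet> v" for v :: "real vec"
    by (auto simp: scalar_prod_def intro: sum_nonneg)
  \<comment> \<open>Used with \<open>c' = k\<close> to identify \<open>k\<close> as the maximum, and
    with \<open>c' = c\<close> for the equivalence.\<close>
  have ev: "l \<le> c'" if l: "eigenvalue A l"
    and c': "\<And>v. v \<in> carrier_vec n \<Longrightarrow> v \<bullet> (A *\<^sub>v v) \<le> c' * (v \<bullet> v)" for l c'
  proof -
    obtain v where v: "v \<in> carrier_vec n" "v \<noteq> 0\<^sub>v n" "A *\<^sub>v v = l \<cdot>\<^sub>v v"
      using l A by (auto simp: eigenvalue_def eigenvector_def)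
    have "v \<bullet> v \<noteq> 0"
    proof
      assume "v \<bullet> v = 0"
      then have "\<forall>i<n. v $ i = 0"
        using v(1) by (auto simp: scalar_prod_def sum_nonneg_eq_0_iff)
      then show False using v(1,2) by auto
    qed
    then have "v \<bullet> v > 0" using pos[of v] by simp
    moreover have "l * (v \<bullet> v) \<le> c' * (v \<bullet> v)"
      using c'[OF v(1)] v(1,3) by simp
    ultimately show ?thesis by simp
  qed
  have "Max {k. eigenvalue A k} = k"
    using k ev by (intro Max_eqI finite_eigenvalues[OF A]) auto
  moreover have "k \<le> c" if "\<forall>v \<in> carrier_vec n. v \<bullet> (A *\<^sub>v v) \<le> c * (v \<bullet> v)"
    using ev[OF k(1)] that by blast
  moreover have "v \<bullet> (A *\<^sub>v v) \<le> c * (v \<bullet> v)" if "k \<le> c" "v \<in> carrier_vec n" for v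
    using bspec[OF k(2) that(2)] mult_right_mono[OF that(1) pos[of v]] by linarith
  ultimately show ?thesis by blast
qed

section \<open>The Laplacian of a graph\<close>

text \<open>Twice the quadratic form of the Laplacian, written for functions on the vertices so that
  later arguments need no numbering of vertices.\<close>

definition dirichlet :: "'a pair_pre_digraph \<Rightarrow> ('a \<Rightarrow> real) \<Rightarrow> real" where
  "dirichlet G x = (\<Sum>(u, v) \<in> parcs G. (x u - x v)\<^sup>2)"

context pair_graph
begin

lemma finite_neighbours: "finite (parcs G `` {u})"
  using pair_finite_arcs by (rule finite_Image)

lemma arc_commute: "(u, v) \<in> parcs G \<longleftrightarrow> (v, u) \<in> parcs G"
  using pair_sym_arcs by (auto simp: symmetric_def dest: symD)

lemma sum_arcs: "(\<Sum>(u, v) \<in> parcs G. g u v) = (\<Sum>u \<in> pverts G. \<Sum>v \<in> parcs G `` {u}. g u v)"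
proof -
  have "(\<Sum>u \<in> pverts G. \<Sum>v \<in> parcs G `` {u}. g u v) =
      (\<Sum>(u, v) \<in> Sigma (pverts G) (\<lambda>u. parcs G `` {u}). g u v)"
    using pair_finite_verts finite_neighbours by (intro sum.Sigma) auto
  also have "Sigma (pverts G) (\<lambda>u. parcs G `` {u}) = parcs G"
    using in_arcsD1 by auto
  finally show ?thesis ..
qed

lemma sum_arcs_swap: "(\<Sum>(u, v) \<in> parcs G. g u v) = (\<Sum>(u, v) \<in> parcs G. g v u)"
  by (rule sum.reindex_bij_witness[of _ prod.swap prod.swap]) (auto simp: arc_commute)

lemma out_degree_eq: "out_degree (with_proj G) u = card (parcs G `` {u})"
proof -
  have "bij_betw snd (out_arcs (with_proj G) u) (parcs G `` {u})"
    by (rule bij_betwI[where g = "Pair u"]) (auto simp: out_arcs_def)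
  then show ?thesis
    by (simp add: out_degree_def bij_betw_same_card)
qed

lemma laplacian_matrix_carrier: "laplacian_matrix G \<in> carrier_mat (card (pverts G)) (card (pverts G))"
  unfolding laplacian_matrix_def degree_matrix_def adjacency_matrix_def
  by (intro minus_carrier_mat mat_carrier)

lemma laplacian_matrix_symmetric: "(laplacian_matrix G)\<^sup>T = laplacian_matrix G"
  by (rule eq_matI)
    (auto simp: laplacian_matrix_def degree_matrix_def adjacency_matrix_def arc_commute)

text \<open>Expand the square. Reversing arcs identifies the two sums of squares, and
  \<open>u\<close> contributes its square once per outgoing arc.\<close>

lemma dirichlet_eq:
  "dirichlet G x =
    2 * (\<Sum>u \<in> pverts G. real (card (parcs G `` {u})) * (x u)\<^sup>2) -
    2 * (\<Sum>u \<in> pverts G. \<Sum>v \<in> parcs G `` {u}. x u * x v)"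
proof -
  have "dirichlet G x =
      (\<Sum>(u, v) \<in> parcs G. (x u)\<^sup>2) + (\<Sum>(u, v) \<in> parcs G. (x v)\<^sup>2) -
      2 * (\<Sum>(u, v) \<in> parcs G. x u * x v)"
  proof -
    have "dirichlet G x = (\<Sum>e \<in> parcs G. (case e of (u, v) \<Rightarrow> (x u)\<^sup>2) +
        (case e of (u, v) \<Rightarrow> (x v)\<^sup>2) - 2 * (case e of (u, v) \<Rightarrow> x u * x v))"
      unfolding dirichlet_def by (intro sum.cong) (auto simp: power2_diff)
    then show ?thesis by (simp add: sum.distrib sum_subtractf sum_distrib_left)
  qed
  also have "(\<Sum>(u, v) \<in> parcs G. (x v)\<^sup>2) = (\<Sum>(u, v) \<in> parcs G. (x u)\<^sup>2)"
    by (rule sum_arcs_swap)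
  finally show ?thesis
    by (simp add: sum_arcs)
qed

text \<open>The bridge from matrices to graphs: the numbering of the vertices is a bijection, so
  sums over indices become sums over vertices.\<close>

lemma laplacian_quadratic_form:
  fixes x :: "'a \<Rightarrow> real"
  defines "v \<equiv> vec (card (pverts G)) (\<lambda>i. x (from_nat_into (pverts G) i))"
  shows "2 * (v \<bullet> (laplacian_matrix G *\<^sub>v v)) = dirichlet G x"
    and "v \<bullet> v = (\<Sum>u \<in> pverts G. (x u)\<^sup>2)"
proof -
  let ?n = "card (pverts G)" and ?f = "from_nat_into (pverts G)"
  have bij: "bij_betw ?f {..<?n} (pverts G)"
    using pair_finite_verts by (rule bij_betw_from_nat_into_finite)
  have inj: "?f i = ?f j \<longleftrightarrow> i = j" if "i < ?n" "j < ?n" for i j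
    using bij that by (auto simp: bij_betw_def inj_on_def)
  \<comment> \<open>The Laplacian entries, indexed by vertices instead of numbers.\<close>
  define a where "a u w = (if u = w then real (card (parcs G `` {u})) else 0) -
    (if (u, w) \<in> parcs G then 1 else 0)" for u w
  have L: "laplacian_matrix G $$ (i, j) = a (?f i) (?f j)" if "i < ?n" "j < ?n" for i j
    using that by (simp add: laplacian_matrix_def degree_matrix_def adjacency_matrix_def a_def
        inj out_degree_eq)
  have inner: "(\<Sum>w \<in> pverts G. a u w * x w) =
      real (card (parcs G `` {u})) * x u - (\<Sum>w \<in> parcs G `` {u}. x w)" if "u \<in> pverts G" for u
  proof -
    have "(\<Sum>w \<in> pverts G. a u w * x w) =
        (\<Sum>w \<in> pverts G. if u = w then real (card (parcs G `` {u})) * x w else 0) -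
        (\<Sum>w \<in> pverts G. if w \<in> parcs G `` {u} then x w else 0)"
      by (subst sum_subtractf[symmetric]) (auto simp: a_def algebra_simps intro!: sum.cong)
    also have "(\<Sum>w \<in> pverts G. if w \<in> parcs G `` {u} then x w else 0) =
        (\<Sum>w \<in> pverts G \<inter> parcs G `` {u}. x w)"
      using pair_finite_verts by (rule sum.inter_restrict[symmetric])
    also have "pverts G \<inter> parcs G `` {u} = parcs G `` {u}"
      using in_arcsD2 by auto
    finally show ?thesis
      using that pair_finite_verts by simp
  qed
  have "v \<bullet> (laplacian_matrix G *\<^sub>v v) =
      (\<Sum>i<?n. x (?f i) * (\<Sum>j<?n. a (?f i) (?f j) * x (?f j)))"
    using laplacian_matrix_carrier L
    by (auto simp: scalar_prod_def row_def v_def lessThan_atLeast0 intro!: sum.cong)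
  also have "\<dots> = (\<Sum>u \<in> pverts G. x u * (\<Sum>w \<in> pverts G. a u w * x w))"
    by (simp only: sum.reindex_bij_betw[OF bij, of "\<lambda>w. a u w * x w" for u]
        sum.reindex_bij_betw[OF bij, of "\<lambda>u. x u * (\<Sum>w \<in> pverts G. a u w * x w)"])
  also have "\<dots> = (\<Sum>u \<in> pverts G. real (card (parcs G `` {u})) * (x u)\<^sup>2 -
      (\<Sum>w \<in> parcs G `` {u}. x u * x w))"
    by (intro sum.cong) (simp_all add: inner right_diff_distrib sum_distrib_left[symmetric]
        power2_eq_square)
  finally show "2 * (v \<bullet> (laplacian_matrix G *\<^sub>v v)) = dirichlet G x"
    by (simp add: dirichlet_eq sum_subtractf)
  have "v \<bullet> v = (\<Sum>i<?n. (x (?f i))\<^sup>2)"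
    by (auto simp: scalar_prod_def v_def lessThan_atLeast0 power2_eq_square intro!: sum.cong)
  then show "v \<bullet> v = (\<Sum>u \<in> pverts G. (x u)\<^sup>2)"
    using sum.reindex_bij_betw[OF bij, of "\<lambda>u. (x u)\<^sup>2"] by simp
qed

text \<open>
  The factor \<open>2\<close> arises because \<^const>\<open>dirichlet\<close> counts every edge in both directions.
\<close>

lemma largest_laplacian_eigenvalue_le_iff:
  assumes "pverts G \<noteq> {}"
  shows "largest_laplacian_eigenvalue G \<le> c \<longleftrightarrow>
    (\<forall>x. dirichlet G x \<le> 2 * c * (\<Sum>u \<in> pverts G. (x u)\<^sup>2))"
proof -
  let ?n = "card (pverts G)" and ?f = "from_nat_into (pverts G)"
  let ?v = "\<lambda>x. vec ?n (\<lambda>i. x (?f i)) :: real vec"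
  have bij: "bij_betw ?f {..<?n} (pverts G)"
    using pair_finite_verts by (rule bij_betw_from_nat_into_finite)
  have n: "0 < ?n" using assms pair_finite_verts by (simp add: card_gt_0_iff)
  \<comment> \<open>Every vector comes from a function on the vertices, so the two universal
    quantifiers are interchangeable.\<close>
  have surj: "\<exists>x. v = ?v x" if "v \<in> carrier_vec ?n" for v
  proof
    show "v = ?v (\<lambda>u. v $ the_inv_into {..<?n} ?f u)"
      using that bij by (intro eq_vecI) (auto simp: bij_betw_def the_inv_into_f_f)
  qed
  have "largest_laplacian_eigenvalue G \<le> c \<longleftrightarrow>
      (\<forall>v \<in> carrier_vec ?n. v \<bullet> (laplacian_matrix G *\<^sub>v v) \<le> c * (v \<bullet> v))"
    using Max_eigenvalue_le_iff[OF laplacian_matrix_carrier laplacian_matrix_symmetric n] assms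
    by (simp add: largest_laplacian_eigenvalue_def)
  also have "\<dots> \<longleftrightarrow> (\<forall>x. ?v x \<bullet> (laplacian_matrix G *\<^sub>v ?v x) \<le> c * (?v x \<bullet> ?v x))"
    using surj by (metis vec_carrier)
  also have "\<dots> \<longleftrightarrow> (\<forall>x. 2 * (?v x \<bullet> (laplacian_matrix G *\<^sub>v ?v x)) \<le> 2 * c * (?v x \<bullet> ?v x))"
    by simp
  also have "\<dots> \<longleftrightarrow> (\<forall>x. dirichlet G x \<le> 2 * c * (\<Sum>u \<in> pverts G. (x u)\<^sup>2))"
    by (simp only: laplacian_quadratic_form)
  finally show ?thesis .
qed

text \<open>This direction also covers the graph without vertices, where both sides vanish, so it
  applies to an empty summand of a disjoint union.\<close>

lemma dirichlet_le_of_largest_laplacian_eigenvalue_le: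
  assumes "largest_laplacian_eigenvalue G \<le> c"
  shows "dirichlet G x \<le> 2 * c * (\<Sum>u \<in> pverts G. (x u)\<^sup>2)"
proof (cases "pverts G = {}")
  case True
  then have "parcs G = {}" using in_arcsD1 by auto
  with True show ?thesis by (simp add: dirichlet_def)
next
  case False
  with assms show ?thesis by (simp add: largest_laplacian_eigenvalue_le_iff)
qed

text \<open>Filling in all missing edges can only increase the form. For the complete graph it
  equals \<open>2 n\<close> times the squared norm minus twice the square of the sum of
  \<open>x\<close>.\<close>

lemma largest_laplacian_eigenvalue_le_card: "largest_laplacian_eigenvalue G \<le> card (pverts G)"
proof (cases "pverts G = {}")
  case True
  then show ?thesis by (simp add: largest_laplacian_eigenvalue_def)
next
  case False
  have "dirichlet G x \<le> 2 * card (pverts G) * (\<Sum>u \<in> pverts G. (x u)\<^sup>2)" for x :: "'a \<Rightarrow> real"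
  proof -
    have "dirichlet G x \<le> (\<Sum>(u, v) \<in> pverts G \<times> pverts G. (x u - x v)\<^sup>2)"
      unfolding dirichlet_def
      using pair_finite_verts by (intro sum_mono2) (auto dest: in_arcsD1 in_arcsD2)
    also have "\<dots> = (\<Sum>u \<in> pverts G. \<Sum>v \<in> pverts G. (x u)\<^sup>2 + (x v)\<^sup>2 - 2 * (x u * x v))"
      unfolding sum.cartesian_product by (intro sum.cong) (auto simp: power2_diff)
    also have "\<dots> = 2 * card (pverts G) * (\<Sum>u \<in> pverts G. (x u)\<^sup>2) - 2 * (\<Sum>u \<in> pverts G. x u)\<^sup>2"
      by (simp add: sum.distrib sum_subtractf sum_distrib_left[symmetric] sum_distrib_right[symmetric]
          power2_eq_square)
    finally show ?thesis using zero_le_power2[of "\<Sum>u \<in> pverts G. x u"] by linarith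
  qed
  with False show ?thesis by (simp add: largest_laplacian_eigenvalue_le_iff)
qed

text \<open>
  For the test vector \<open>x\<close> of the proof, the edges at \<open>v\<close> alone already give the Rayleigh quotient
  \<open>deg v + 1\<close>; an edge leaving the closed neighbourhood would make it larger.
\<close>

lemma degree_less_largest_laplacian_eigenvalue:
  assumes v: "v \<in> pverts G" and ne: "parcs G `` {v} \<noteq> {}"
  shows "card (parcs G `` {v}) + 1 \<le> largest_laplacian_eigenvalue G"
    and "largest_laplacian_eigenvalue G = card (parcs G `` {v}) + 1 \<Longrightarrow>
      parcs G `` insert v (parcs G `` {v}) \<subseteq> insert v (parcs G `` {v})"
proof -
  define N where "N = parcs G `` {v}"
  define d where "d = real (card N)"
  define lam where "lam = largest_laplacian_eigenvalue G"
  \<comment> \<open>This is the eigenvector of the star at \<open>v\<close> for its largest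
    eigenvalue \<open>d + 1\<close>. It differs by \<open>d + 1\<close> along each edge at
    \<open>v\<close> and has squared norm \<open>d (d + 1)\<close>.\<close>
  define x where "x u = (if u = v then d else if u \<in> N then -1 else 0)" for u
  have fN: "finite N" unfolding N_def by (rule finite_neighbours)
  have vN: "v \<notin> N" using pair_no_loops[of "(v, v)"] by (auto simp: N_def)
  have NV: "N \<subseteq> pverts G" using in_arcsD2 by (auto simp: N_def)
  have d: "d > 0" using fN ne by (simp add: d_def N_def card_gt_0_iff)
  have "(\<Sum>u \<in> pverts G. (x u)\<^sup>2) = (\<Sum>u \<in> insert v N. (x u)\<^sup>2)"
    using v NV pair_finite_verts by (intro sum.mono_neutral_right) (auto simp: x_def)
  also have "\<dots> = d\<^sup>2 + (\<Sum>u \<in> N. (x u)\<^sup>2)"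
    using fN vN by (simp add: x_def)
  also have "(\<Sum>u \<in> N. (x u)\<^sup>2) = (\<Sum>u \<in> N. 1)"
    using vN by (intro sum.cong) (auto simp: x_def)
  finally have norm: "(\<Sum>u \<in> pverts G. (x u)\<^sup>2) = d * (d + 1)"
    by (simp add: d_def power2_eq_square algebra_simps)
  have upper: "dirichlet G x \<le> 2 * lam * (d * (d + 1))"
    using dirichlet_le_of_largest_laplacian_eigenvalue_le[of lam x] norm by (simp add: lam_def)
  \<comment> \<open>The \<open>2 d\<close> arcs at \<open>v\<close>, in both directions.\<close>
  define S where "S = {v} \<times> N \<union> N \<times> {v}"
  have S: "S \<subseteq> parcs G" by (auto simp: S_def N_def arc_commute)
  have "(\<Sum>(u, w) \<in> S. (x u - x w)\<^sup>2) =
      (\<Sum>(u, w) \<in> {v} \<times> N. (x u - x w)\<^sup>2) + (\<Sum>(u, w) \<in> N \<times> {v}. (x u - x w)\<^sup>2)"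
    unfolding S_def using fN vN by (intro sum.union_disjoint) auto
  also have "(\<Sum>(u, w) \<in> {v} \<times> N. (x u - x w)\<^sup>2) = (\<Sum>e \<in> {v} \<times> N. (d + 1)\<^sup>2)"
    using vN by (intro sum.cong) (auto simp: x_def)
  also have "(\<Sum>(u, w) \<in> N \<times> {v}. (x u - x w)\<^sup>2) = (\<Sum>e \<in> N \<times> {v}. (d + 1)\<^sup>2)"
    using vN by (intro sum.cong) (auto simp: x_def power2_eq_square algebra_simps)
  finally have sumS: "(\<Sum>(u, w) \<in> S. (x u - x w)\<^sup>2) = 2 * (d + 1) * (d * (d + 1))"
    by (simp add: d_def card_cartesian_product power2_eq_square algebra_simps)
  have "2 * (d + 1) * (d * (d + 1)) \<le> dirichlet G x"
    unfolding sumS[symmetric] dirichlet_def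
    using S pair_finite_arcs by (intro sum_mono2) auto
  with upper have "(2 * (d + 1)) * (d * (d + 1)) \<le> (2 * lam) * (d * (d + 1))" by linarith
  then show "card (parcs G `` {v}) + 1 \<le> largest_laplacian_eigenvalue G"
    using d by (simp add: d_def N_def lam_def)
  assume eq: "largest_laplacian_eigenvalue G = card (parcs G `` {v}) + 1"
  show "parcs G `` insert v (parcs G `` {v}) \<subseteq> insert v (parcs G `` {v})"
  proof (rule ccontr)
    assume "\<not> ?thesis"
    then obtain u w where e: "(u, w) \<in> parcs G" and u: "u \<in> insert v (parcs G `` {v})"
      and w: "w \<notin> insert v (parcs G `` {v})"
      by blast
    \<comment> \<open>An escaping arc must start at a neighbour of \<open>v\<close>, as the
      neighbours of \<open>v\<close> itself lie inside. There \<open>x\<close> steps from -1 to 0,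
      and the extra 1 exceeds the upper bound.\<close>
    then have uN: "u \<in> N" using e u by (auto simp: N_def)
    have "(u, w) \<notin> S" using w uN vN by (auto simp: S_def N_def)
    then have "(\<Sum>(u, w) \<in> insert (u, w) S. (x u - x w)\<^sup>2) = (x u - x w)\<^sup>2 + 2 * (d + 1) * (d * (d + 1))"
      using S finite_subset[OF S pair_finite_arcs] sumS by simp
    moreover have "(x u - x w)\<^sup>2 = 1"
      using uN w vN by (auto simp: x_def N_def)
    moreover have "(\<Sum>(u, w) \<in> insert (u, w) S. (x u - x w)\<^sup>2) \<le> dirichlet G x"
      unfolding dirichlet_def
      using S e pair_finite_arcs by (intro sum_mono2) auto
    moreover have "lam = d + 1" using eq by (simp add: lam_def d_def N_def)
    ultimately show False using upper by simp
  qed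
qed

section \<open>Domination\<close>

lemma finite_dominating: "finite {X. dominating G X}"
  using pair_finite_verts by (auto simp: dominating_def intro: finite_subset[of _ "Pow (pverts G)"])

lemma dominating_verts: "dominating G (pverts G)"
  by (simp add: dominating_def)

lemma domination_number_le: "dominating G X \<Longrightarrow> domination_number G \<le> card X"
  unfolding domination_number_def using finite_dominating by (intro Min_le) auto

lemma minimum_dominating_set:
  obtains X where "dominating G X" "card X = domination_number G"
proof -
  have "domination_number G \<in> card ` {X. dominating G X}"
    unfolding domination_number_def
    using finite_dominating dominating_verts by (intro Min_in) auto
  then show thesis using that by auto
qed

text \<open>The degree bound is strict because \<open>m\<close> has to bound the closed
  neighbourhood, which contains the vertex itself.\<close>

lemma card_verts_le_domination_number:
  assumes "\<And>v. v \<in> pverts G \<Longrightarrow> card (parcs G `` {v}) < m"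
  shows "card (pverts G) \<le> domination_number G * m"
proof -
  obtain X where X: "dominating G X" "card X = domination_number G"
    using minimum_dominating_set .
  have XV: "X \<subseteq> pverts G" using X(1) by (simp add: dominating_def)
  then have fX: "finite X" using pair_finite_verts finite_subset by blast
  have "pverts G \<subseteq> (\<Union>v \<in> X. insert v (parcs G `` {v}))"
    using X(1) arc_commute by (fastforce simp: dominating_def)
  then have "card (pverts G) \<le> card (\<Union>v \<in> X. insert v (parcs G `` {v}))"
    using fX finite_neighbours by (intro card_mono) auto
  also have "\<dots> \<le> (\<Sum>v \<in> X. card (insert v (parcs G `` {v})))"
    using fX by (rule card_UN_le)
  also have "\<dots> \<le> (\<Sum>v \<in> X. m)"
    using XV assms
    by (intro sum_mono) (force simp: card_insert_if finite_neighbours Suc_le_eq less_imp_le)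
  finally show ?thesis using X(2) by simp
qed

end

text \<open>One vertex adjacent to all others dominates, and the empty set cannot dominate a graph
  that has a vertex.\<close>

lemma domination_number_eq_1:
  assumes G: "pair_graph G" and v: "v \<in> pverts G"
    and adj: "\<And>u. u \<in> pverts G \<Longrightarrow> u \<noteq> v \<Longrightarrow> (u, v) \<in> parcs G"
  shows "domination_number G = 1"
proof -
  interpret pair_graph G by (rule G)
  have "dominating G {v}" using v adj by (auto simp: dominating_def)
  then have "domination_number G \<le> 1" using domination_number_le by force
  moreover have "domination_number G \<noteq> 0"
  proof
    assume "domination_number G = 0"
    then obtain X where X: "dominating G X" "card X = 0"
      using minimum_dominating_set by metis
    then have "finite X"
      using pair_finite_verts by (auto simp: dominating_def intro: finite_subset)
    with X v show False by (auto simp: dominating_def)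
  qed
  ultimately show ?thesis by linarith
qed

section \<open>Eigenvalues and domination numbers of disjoint unions\<close>

locale disjoint_union_graphs =
  G1: pair_graph G1 + G2: pair_graph G2 + G: pair_graph G
  for G G1 G2 :: "'a pair_pre_digraph" +
  assumes union: "is_disjoint_union G G1 G2"
begin

lemma verts_union: "pverts G = pverts G1 \<union> pverts G2" "pverts G1 \<inter> pverts G2 = {}"
  and arcs_union: "parcs G = parcs G1 \<union> parcs G2" "parcs G1 \<inter> parcs G2 = {}"
proof -
  show V: "pverts G = pverts G1 \<union> pverts G2" "pverts G1 \<inter> pverts G2 = {}"
    "parcs G = parcs G1 \<union> parcs G2"
    using union by (auto simp: is_disjoint_union_def)
  show "parcs G1 \<inter> parcs G2 = {}"
    using V(2) G1.in_arcsD1 G2.in_arcsD1 by fast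
qed

lemma dirichlet_union: "dirichlet G x = dirichlet G1 x + dirichlet G2 x"
  unfolding dirichlet_def arcs_union(1)
  using G1.pair_finite_arcs G2.pair_finite_arcs arcs_union(2) by (rule sum.union_disjoint)

lemma sum_verts_union: "sum g (pverts G) = sum g (pverts G1) + sum g (pverts G2)"
  unfolding verts_union(1)
  using G1.pair_finite_verts G2.pair_finite_verts verts_union(2) by (rule sum.union_disjoint)

text \<open>The Dirichlet form and the squared norm are both additive, so a common bound for the
  summands adds up.\<close>

lemma largest_laplacian_eigenvalue_union_le:
  assumes "largest_laplacian_eigenvalue G1 \<le> c" "largest_laplacian_eigenvalue G2 \<le> c"
    and "pverts G \<noteq> {}"
  shows "largest_laplacian_eigenvalue G \<le> c"
  unfolding G.largest_laplacian_eigenvalue_le_iff[OF assms(3)]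
  using G1.dirichlet_le_of_largest_laplacian_eigenvalue_le[OF assms(1)]
    G2.dirichlet_le_of_largest_laplacian_eigenvalue_le[OF assms(2)]
  by (auto simp: dirichlet_union sum_verts_union distrib_left intro: add_mono)

text \<open>A test function on \<open>G2\<close>, extended by zero, keeps its Dirichlet form and its
  norm in \<open>G\<close>.\<close>

lemma largest_laplacian_eigenvalue_summand_le:
  assumes "pverts G2 \<noteq> {}"
  shows "largest_laplacian_eigenvalue G2 \<le> largest_laplacian_eigenvalue G"
  unfolding G2.largest_laplacian_eigenvalue_le_iff[OF assms]
proof
  fix x :: "'a \<Rightarrow> real"
  define y where "y u = (if u \<in> pverts G2 then x u else 0)" for u
  have "dirichlet G1 y = 0"
    using verts_union(2) G1.in_arcsD1 G1.in_arcsD2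
    unfolding dirichlet_def y_def by (intro sum.neutral) (auto, blast+)
  moreover have "dirichlet G2 y = dirichlet G2 x"
    unfolding dirichlet_def y_def using G2.in_arcsD1 G2.in_arcsD2 by (intro sum.cong) auto
  moreover have "(\<Sum>u \<in> pverts G1. (y u)\<^sup>2) = 0"
    unfolding y_def using verts_union(2) by (intro sum.neutral) auto
  moreover have "(\<Sum>u \<in> pverts G2. (y u)\<^sup>2) = (\<Sum>u \<in> pverts G2. (x u)\<^sup>2)"
    unfolding y_def by simp
  ultimately show "dirichlet G2 x \<le> 2 * largest_laplacian_eigenvalue G * (\<Sum>u \<in> pverts G2. (x u)\<^sup>2)"
    using G.dirichlet_le_of_largest_laplacian_eigenvalue_le[OF order_refl, of y]
    by (simp add: dirichlet_union sum_verts_union)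
qed

text \<open>Dominating sets of the summands unite to one of \<open>G\<close>. Conversely, a
  dominating set of \<open>G\<close> restricts to each summand, because no arc leaves a
  summand.\<close>

lemma domination_number_union:
  "domination_number G = domination_number G1 + domination_number G2"
proof (rule antisym)
  obtain X1 where X1: "dominating G1 X1" "card X1 = domination_number G1"
    using G1.minimum_dominating_set .
  obtain X2 where X2: "dominating G2 X2" "card X2 = domination_number G2"
    using G2.minimum_dominating_set .
  have "dominating G (X1 \<union> X2)"
    using X1(1) X2(1) verts_union arcs_union by (fastforce simp: dominating_def)
  then show "domination_number G \<le> domination_number G1 + domination_number G2"
    using G.domination_number_le card_Un_le[of X1 X2] X1(2) X2(2) by fastforce
next
  obtain X where X: "dominating G X" "card X = domination_number G"
    using G.minimum_dominating_set .
  have XV: "X \<subseteq> pverts G" using X(1) by (simp add: dominating_def)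
  have restrict: "dominating H (X \<inter> pverts H)"
    if "pair_graph H" and sub: "pverts H \<subseteq> pverts G"
      and arcs: "\<And>u w. (u, w) \<in> parcs G \<Longrightarrow> u \<in> pverts H \<Longrightarrow> (u, w) \<in> parcs H" for H
    unfolding dominating_def
  proof (intro conjI ballI)
    interpret H: pair_graph H by fact
    fix u assume u: "u \<in> pverts H - X \<inter> pverts H"
    then obtain w where "w \<in> X" "(u, w) \<in> parcs G"
      using X(1) sub unfolding dominating_def by blast
    with u show "\<exists>w \<in> X \<inter> pverts H. (u, w) \<in> parcs H"
      using arcs H.in_arcsD2 by blast
  qed simp
  have "dominating G1 (X \<inter> pverts G1)"
    using verts_union arcs_union(1) G2.in_arcsD1 by (intro restrict G1.pair_graph) auto
  moreover have "dominating G2 (X \<inter> pverts G2)"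
    using verts_union arcs_union(1) G1.in_arcsD1 by (intro restrict G2.pair_graph) (auto, blast)
  ultimately have "domination_number G1 + domination_number G2
      \<le> card (X \<inter> pverts G1) + card (X \<inter> pverts G2)"
    by (simp add: add_mono G1.domination_number_le G2.domination_number_le)
  also have "\<dots> = card (X \<inter> pverts G1 \<union> X \<inter> pverts G2)"
    using G1.pair_finite_verts G2.pair_finite_verts verts_union(2)
    by (intro card_Un_disjoint[symmetric]) auto
  also have "X \<inter> pverts G1 \<union> X \<inter> pverts G2 = X"
    using XV verts_union(1) by auto
  finally show "domination_number G1 + domination_number G2 \<le> domination_number G"
    using X(2) by simp
qed

end

section \<open>Splitting off a closed neighbourhood\<close>

lemma (in pair_graph) closed_neighbourhood_splits:
  assumes v: "v \<in> pverts G"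
    and closed: "parcs G `` insert v (parcs G `` {v}) \<subseteq> insert v (parcs G `` {v})"
  obtains G1 G2 where "disjoint_union_graphs G G1 G2" "domination_number G1 = 1"
    "card (pverts G1) = card (parcs G `` {v}) + 1"
proof -
  define C where "C = insert v (parcs G `` {v})"
  define G1 where "G1 = \<lparr>pverts = C, parcs = parcs G \<inter> C \<times> C\<rparr>"
  define G2 where "G2 = \<lparr>pverts = pverts G - C, parcs = parcs G - C \<times> C\<rparr>"
  have CV: "C \<subseteq> pverts G" using v in_arcsD2 by (auto simp: C_def)
  \<comment> \<open>Since \<open>C\<close> is closed under arcs and arcs are symmetric, an arc not
    inside \<open>C\<close> avoids \<open>C\<close> altogether. Hence the arcs given to
    \<open>G2\<close> stay among its vertices.\<close>
  have out: "u \<notin> C \<and> w \<notin> C" if "(u, w) \<in> parcs G" "\<not> (u \<in> C \<and> w \<in> C)" for u w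
    using closed that arc_commute[of u w] unfolding C_def by blast
  have symG: "sym (parcs G)" using arc_commute by (auto intro: symI)
  have sg: "pair_graph \<lparr>pverts = V, parcs = A\<rparr>"
    if "V \<subseteq> pverts G" "A \<subseteq> parcs G" "A \<subseteq> V \<times> V" "sym A" for V A
    using that finite_subset[OF _ pair_finite_verts] finite_subset[OF _ pair_finite_arcs] pair_no_loops
    by unfold_locales (auto simp: symmetric_def)
  have "pair_graph G1"
    unfolding G1_def using CV symG by (intro sg) (auto simp: sym_def)
  moreover have "pair_graph G2"
    unfolding G2_def
  proof (rule sg)
    show "parcs G - C \<times> C \<subseteq> (pverts G - C) \<times> (pverts G - C)"
      using out in_arcsD1 in_arcsD2 by auto
    show "sym (parcs G - C \<times> C)"
      using symG by (auto simp: sym_def)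
  qed auto
  moreover have "is_disjoint_union G G1 G2"
    using CV by (auto simp: is_disjoint_union_def G1_def G2_def intro!: pair_pre_digraph.equality)
  ultimately have "disjoint_union_graphs G G1 G2"
    by (simp add: disjoint_union_graphs_def disjoint_union_graphs_axioms_def pair_graph)
  moreover have "domination_number G1 = 1"
    using \<open>pair_graph G1\<close>
    by (rule domination_number_eq_1[where v = v]) (auto simp: G1_def C_def arc_commute)
  moreover have "v \<notin> parcs G `` {v}" using pair_no_loops[of "(v, v)"] by auto
  then have "card (pverts G1) = card (parcs G `` {v}) + 1"
    using finite_neighbours by (simp add: G1_def C_def)
  ultimately show thesis by (rule that)
qed

lemma (in pair_graph) maximum_degree_vertex:
  assumes "pverts G \<noteq> {}"
  obtains v where "v \<in> pverts G"
    "\<And>u. u \<in> pverts G \<Longrightarrow> card (parcs G `` {u}) \<le> card (parcs G `` {v})"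
proof -
  define D where "D = (\<lambda>u. card (parcs G `` {u})) ` pverts G"
  have D: "finite D" "D \<noteq> {}" using assms pair_finite_verts by (auto simp: D_def)
  obtain v where "v \<in> pverts G" "card (parcs G `` {v}) = Max D"
    using Max_in[OF D] unfolding D_def by fastforce
  with Max_ge[OF D(1)] show thesis by (intro that[of v]) (auto simp: D_def)
qed

text \<open>The assumption \<open>has_edge\<close> excludes edgeless graphs, for which the bound
  fails: there \<open>\<gamma> = n\<close>, so the ceiling is 1, while the largest eigenvalue is
  0.\<close>

theorem theorem3:
  fixes G :: "'a pair_pre_digraph" and n \<gamma> :: nat
  assumes "pair_graph G"
    and "card (pverts G) = n" and "n \<ge> 2"
    and "domination_number G = \<gamma>" and "\<gamma> > 0"
    and has_edge: "parcs G \<noteq> {}"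
  shows "largest_laplacian_eigenvalue G \<ge> of_int \<lceil>real n / real \<gamma>\<rceil> \<and>
    (largest_laplacian_eigenvalue G = of_int \<lceil>real n / real \<gamma>\<rceil> \<longleftrightarrow>
      (\<exists>G1 G2. pair_graph G1 \<and> pair_graph G2 \<and> is_disjoint_union G G1 G2 \<and>
        int (card (pverts G1)) = \<lceil>real n / real \<gamma>\<rceil> \<and> domination_number G1 = 1 \<and>
        domination_number G2 = \<gamma> - 1 \<and>
        largest_laplacian_eigenvalue G2 \<le> of_int \<lceil>real n / real \<gamma>\<rceil>))"
proof -
  interpret pair_graph G by fact
  define c where "c = \<lceil>real n / real \<gamma>\<rceil>"
  define lam where "lam = largest_laplacian_eigenvalue G"
  have V: "pverts G \<noteq> {}" using assms(2,3) by auto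
  obtain v where v: "v \<in> pverts G"
    and max: "\<And>u. u \<in> pverts G \<Longrightarrow> card (parcs G `` {u}) \<le> card (parcs G `` {v})"
    using maximum_degree_vertex[OF V] by metis
  define d where "d = card (parcs G `` {v})"
  \<comment> \<open>An edge makes the maximum degree positive, as the test vector at
    \<open>v\<close> requires.\<close>
  obtain a b where ab: "(a, b) \<in> parcs G" using has_edge by auto
  then have "parcs G `` {a} \<noteq> {}" "a \<in> pverts G" using in_arcsD1 by auto
  then have "d > 0"
    using max[of a] finite_neighbours[of a] by (metis card_gt_0_iff d_def order_less_le_trans)
  then have ne: "parcs G `` {v} \<noteq> {}" by (auto simp: d_def)
  have lam: "d + 1 \<le> lam"
    unfolding d_def lam_def by (rule degree_less_largest_laplacian_eigenvalue(1)[OF v ne])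
  have "n \<le> \<gamma> * (d + 1)"
    using card_verts_le_domination_number[of "d + 1"] max assms(2,4) by (auto simp: d_def le_imp_less_Suc)
  then have "real n \<le> real \<gamma> * real (d + 1)"
    by (metis of_nat_le_iff of_nat_mult)
  then have "real n / real \<gamma> \<le> real (d + 1)"
    using \<open>\<gamma> > 0\<close> by (simp add: divide_le_eq mult.commute)
  then have cd: "c \<le> int (d + 1)"
    unfolding c_def by (simp add: ceiling_le_iff)
  have ge: "of_int c \<le> lam" using cd lam by linarith
  have "lam = of_int c \<longleftrightarrow>
      (\<exists>G1 G2. pair_graph G1 \<and> pair_graph G2 \<and> is_disjoint_union G G1 G2 \<and>
        int (card (pverts G1)) = c \<and> domination_number G1 = 1 \<and>
        domination_number G2 = \<gamma> - 1 \<and> largest_laplacian_eigenvalue G2 \<le> of_int c)"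
    (is "_ \<longleftrightarrow> ?R")
  proof
    assume eq: "lam = of_int c"
    \<comment> \<open>Equality collapses the chain \<open>c \<le> d + 1 \<le> lam\<close>.\<close>
    then have c: "c = int (d + 1)" using cd lam by linarith
    then have "largest_laplacian_eigenvalue G = card (parcs G `` {v}) + 1"
      using eq by (simp add: lam_def d_def)
    note closed = degree_less_largest_laplacian_eigenvalue(2)[OF v ne this]
    obtain G1 G2 where G12: "disjoint_union_graphs G G1 G2" "domination_number G1 = 1"
      "card (pverts G1) = card (parcs G `` {v}) + 1"
      by (metis closed_neighbourhood_splits[OF v closed])
    interpret disjoint_union_graphs G G1 G2 by (rule G12(1))
    \<comment> \<open>Additivity gives \<open>\<gamma> = 1 + domination_number G2\<close>, so the
      subtraction on naturals is exact.\<close>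
    have "domination_number G2 = \<gamma> - 1"
      using domination_number_union G12(2) assms(4) by simp
    moreover have "largest_laplacian_eigenvalue G2 \<le> of_int c"
    proof (cases "pverts G2 = {}")
      case True
      \<comment> \<open>An empty \<open>G2\<close> has the default eigenvalue 0, which is below the
        positive \<open>c = d + 1\<close>.\<close>
      then show ?thesis by (simp add: largest_laplacian_eigenvalue_def c)
    next
      case False
      then show ?thesis
        using largest_laplacian_eigenvalue_summand_le eq by (simp add: lam_def)
    qed
    moreover have "int (card (pverts G1)) = c" using c G12(3) by (simp add: d_def)
    ultimately show ?R
      using G12(2) G1.pair_graph G2.pair_graph union by blast
  next
    assume ?R
    then obtain G1 G2 where G12: "pair_graph G1" "pair_graph G2" "is_disjoint_union G G1 G2"
      "int (card (pverts G1)) = c" "largest_laplacian_eigenvalue G2 \<le> of_int c"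
      by blast
    interpret disjoint_union_graphs G G1 G2
      using G12(1-3) pair_graph by (simp add: disjoint_union_graphs_def disjoint_union_graphs_axioms_def)
    have "largest_laplacian_eigenvalue G1 \<le> of_int c"
      using G1.largest_laplacian_eigenvalue_le_card G12(4) by (metis of_int_of_nat_eq)
    then have "lam \<le> of_int c"
      unfolding lam_def using G12(5) V by (rule largest_laplacian_eigenvalue_union_le)
    with ge show "lam = of_int c" by simp
  qed
  with ge show ?thesis
    unfolding lam_def c_def by blast
qed

end
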